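(* Let $p$ and $q$ be integers with $q\geq 0$, and let $n\geq 1$ be an integer. Then \[ q!\,H_n^{(p,q+1)}=\sum_{k=0}^{q}(-1)^{k}\genfrac{[}{]}{0pt}{}{q}{k}_{n+1}H_n^{(p-k)}. \]
   Context: For $p\in\mathbb{Z}$ and $n\geq1$, $H_n^{(p)}=\sum_{j=1}^{n}j^{-p}$ (generalized harmonic number; $H_0^{(p)}=0$). The generalized hyperharmonic numbers are defined by $H_n^{(p,0)}=1/n^{p}$ and $H_n^{(p,r)}=\sum_{k=1}^{n}H_k^{(p,r-1)}$ for $r\geq1$ (so $H_n^{(p,1)}=H_n^{(p)}$). The $r$-Stirling numbers of the first kind $\genfrac{[}{]}{0pt}{}{q}{j}_{r}$ are defined by $(x+r)(x+r+1)\cdots(x+r+q-1)=\sum_{j=0}^{q}\genfrac{[}{]}{0pt}{}{q}{j}_{r}x^{j}$. *)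

theory Defs
  imports Complex_Main "HOL-Computational_Algebra.Polynomial"
begin

definition gen_harm :: "int \<Rightarrow> nat \<Rightarrow> real" where
  "gen_harm p n = (\<Sum>j=1..n. real j powi (- p))"

text \<open>
  \<open>gen_hyperharm p r n\<close> is $H_n^{(p,r)}$. At order \<open>r = 0\<close> it is meaningful only for \<open>n \<ge> 1\<close>;
  its value at \<open>n = 0\<close> is never used by the higher orders, whose sums start at \<open>k = 1\<close>.
\<close>

fun gen_hyperharm :: "int \<Rightarrow> nat \<Rightarrow> nat \<Rightarrow> real" where
  "gen_hyperharm p 0 n = 1 / (real n powi p)"
| "gen_hyperharm p (Suc r) n = (\<Sum>k=1..n. gen_hyperharm p r k)"

text \<open>
  \<open>rstirling1 r q j\<close> is the (unsigned) \<open>r\<close>-Stirling number with upper entry \<open>q\<close>, lower entry \<open>j\<close>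
  and subscript \<open>r\<close>: the coefficient of \<open>x ^ j\<close> in \<open>(x + r) (x + r + 1) \<dots> (x + r + q - 1)\<close>.
  In the convention where the entries are shifted by \<open>r\<close>, it has upper entry \<open>q + r\<close> and
  lower entry \<open>j + r\<close>.
\<close>

definition rstirling1 :: "nat \<Rightarrow> nat \<Rightarrow> nat \<Rightarrow> int" where
  "rstirling1 r q j = coeff (\<Prod>i<q. [:int (r + i), 1:]) j"

end

theory Submission
  imports Defs
begin

text \<open>
  Iterated summation gives $H_n^{(p,q+1)} = \sum_{j=1}^n \binom{n-j+q}{q} j^{-p}$ by Pascal's rule.
  Moreover $q! \binom{n-j+q}{q} = (n+1-j) (n+2-j) \cdots (n+q-j)$ is the generating polynomial of
  the $(n+1)$-Stirling numbers at $x = -j$; expanding it and exchanging the two sums yields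
  the theorem.
\<close>

lemma gen_hyperharm_Suc_eq_sum_binomial:
  "gen_hyperharm p (Suc q) n = (\<Sum>j=1..n. real ((n - j + q) choose q) * real j powi (- p))"
proof (induction q arbitrary: n)
  case 0
  show ?case by (simp add: power_int_minus divide_inverse)
next
  case (Suc q)
  note hyp = Suc.IH
  show ?case
  \<comment> \<open>An inner induction on \<open>n\<close> fits because going from \<open>n\<close>
    to \<open>Suc n\<close> appends one summand, \<open>gen_hyperharm p (Suc q) (Suc n)\<close>, to
    the defining sum. The outer hypothesis \<open>hyp\<close> evaluates exactly that
    summand.\<close>
  proof (induction n)
    case 0
    show ?case by simp
  next
    case (Suc n)
    \<comment> \<open>For j \<le> n the truncated difference satisfies
      \<open>Suc n - j = Suc (n - j)\<close>, which exposes the successors in Pascal's rule.\<close>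
    have pascal: "(Suc n - j + Suc q) choose Suc q
        = ((n - j + Suc q) choose Suc q) + ((Suc n - j + q) choose q)" if "j \<in> {1..n}" for j
      using that by (simp add: Suc_diff_le)
    have "gen_hyperharm p (Suc (Suc q)) (Suc n)
        = gen_hyperharm p (Suc (Suc q)) n + gen_hyperharm p (Suc q) (Suc n)"
      by simp
    also have "\<dots> = (\<Sum>j=1..n. real ((n - j + Suc q) choose Suc q) * real j powi (- p))
        + (\<Sum>j=1..Suc n. real ((Suc n - j + q) choose q) * real j powi (- p))"
      by (simp only: Suc.IH hyp)
    \<comment> \<open>The term \<open>j = Suc n\<close> occurs only in the second sum, with
      coefficient \<open>q choose q = 1\<close>. It is split off, and the other terms merge by
      \<open>pascal\<close>.\<close>
    also have "\<dots> = (\<Sum>j=1..n. real ((Suc n - j + Suc q) choose Suc q) * real j powi (- p))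
        + real (Suc n) powi (- p)"
      using pascal by (simp add: sum.distrib[symmetric] distrib_right del: binomial_Suc_Suc)
    also have "\<dots> = (\<Sum>j=1..Suc n. real ((Suc n - j + Suc q) choose Suc q) * real j powi (- p))"
      by simp
    finally show ?case .
  qed
qed

lemma sum_rstirling1_power:
  "(\<Sum>k=0..q. rstirling1 r q k * x ^ k) = (\<Prod>i<q. x + int (r + i))"
proof -
  define P where "P = (\<Prod>i<q. [:int (r + i), 1:])"
  \<comment> \<open>With degree exactly \<open>q\<close>, the sum up to \<open>q\<close> runs over
    all coefficients needed to evaluate \<open>P\<close>.\<close>
  have "degree P = q"
    unfolding P_def by (subst degree_prod_eq_sum_degree) auto
  then have "(\<Sum>k=0..q. rstirling1 r q k * x ^ k) = poly P x"
    by (simp only: rstirling1_def P_def poly_altdef atMost_atLeast0)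
  also have "\<dots> = (\<Prod>i<q. x + int (r + i))"
    by (simp add: P_def poly_prod add.commute)
  finally show ?thesis .
qed

text \<open>Both sides are the rising factorial of n - j + 1 with \<open>q\<close> factors; j \<le>
  n makes the natural subtraction agree with the one in the field.\<close>

lemma fact_mult_binomial_eq_prod:
  assumes "j \<le> n"
  shows "fact q * of_nat ((n - j + q) choose q)
    = (\<Prod>i<q. - of_nat j + of_nat (n + 1 + i) :: 'a::field_char_0)"
proof -
  have "fact q * of_nat ((n - j + q) choose q) = (pochhammer (of_nat (n - j) + 1) q :: 'a)"
    using gbinomial_pochhammer'[of "of_nat (n - j + q) :: 'a" q]
    by (simp add: binomial_gbinomial del: of_nat_add) (simp add: add.commute)
  also have "\<dots> = (\<Prod>i<q. - of_nat j + of_nat (n + 1 + i))"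
    using assms by (auto simp: pochhammer_prod atLeast0LessThan of_nat_diff algebra_simps intro!: prod.cong)
  finally show ?thesis .
qed

theorem theorem1:
  fixes p :: int and q n :: nat
  assumes "n \<ge> 1"
  shows "fact q * gen_hyperharm p (q + 1) n =
    (\<Sum>k=0..q. (-1) ^ k * of_int (rstirling1 (n + 1) q k) * gen_harm (p - int k) n)"
proof -
  have "fact q * gen_hyperharm p (q + 1) n
      = (\<Sum>j=1..n. (fact q * real ((n - j + q) choose q)) * real j powi (- p))"
    by (simp only: gen_hyperharm_Suc_eq_sum_binomial Suc_eq_plus1[symmetric] sum_distrib_left mult.assoc)
  also have "\<dots> = (\<Sum>j=1..n. (\<Sum>k=0..q. of_int (rstirling1 (n + 1) q k) * (- real j) ^ k)
      * real j powi (- p))"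
  proof (intro sum.cong refl arg_cong2[of _ _ _ _ "(*)"])
    fix j assume "j \<in> {1..n}"
    then have "fact q * real ((n - j + q) choose q) = (\<Prod>i<q. - real j + real (n + 1 + i))"
      by (intro fact_mult_binomial_eq_prod) simp
    \<comment> \<open>The detour through the integers allows \<open>sum_rstirling1_power\<close> to
      be applied at x = -j with r = n + 1.\<close>
    also have "\<dots> = of_int (\<Prod>i<q. - int j + int (n + 1 + i))"
      by simp
    also have "\<dots> = (\<Sum>k=0..q. of_int (rstirling1 (n + 1) q k) * (- real j) ^ k)"
      by (subst sum_rstirling1_power[symmetric]) simp
    finally show "fact q * real ((n - j + q) choose q)
        = (\<Sum>k=0..q. of_int (rstirling1 (n + 1) q k) * (- real j) ^ k)" .
  qed
  also have "\<dots> = (\<Sum>j=1..n. \<Sum>k=0..q.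
      of_int (rstirling1 (n + 1) q k) * (- real j) ^ k * real j powi (- p))"
    by (simp only: sum_distrib_right)
  also have "\<dots> = (\<Sum>j=1..n. \<Sum>k=0..q.
      (-1) ^ k * of_int (rstirling1 (n + 1) q k) * real j powi (- (p - int k)))"
  proof (intro sum.cong refl)
    fix j k assume "j \<in> {1..n}"
    \<comment> \<open>Here j \<ge> 1 matters: the exponent law for \<open>powi\<close> can fail at
      base 0 when the exponents add up to 0.\<close>
    then have "real j powi (- (p - int k)) = real j ^ k * real j powi (- p)"
      using power_int_add[of "real j" "int k" "- p"] by simp
    then show "of_int (rstirling1 (n + 1) q k) * (- real j) ^ k * real j powi (- p)
        = (-1) ^ k * of_int (rstirling1 (n + 1) q k) * real j powi (- (p - int k))"
      by (simp add: power_minus[of "real j"])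
  qed
  also have "\<dots> = (\<Sum>k=0..q. (-1) ^ k * of_int (rstirling1 (n + 1) q k) * gen_harm (p - int k) n)"
    unfolding gen_harm_def sum_distrib_left by (rule sum.swap)
  finally show ?thesis .
qed

end
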